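(* Let $\mathcal{B},\mathcal{C}$ be $\sqrt{\mathfrak{gl}_n}$-crystals. Then the set $\mathcal{B}\otimes\mathcal{C}=\{b\otimes c: b\in\mathcal{B}, c\in\mathcal{C}\}$ is a $\sqrt{\mathfrak{gl}_n}$-crystal with $\operatorname{wt}(b\otimes c)=\operatorname{wt}(b)+\operatorname{wt}(c)$ and, for $i\in[n-1]$, $e'_i(b\otimes c)=b\otimes e'_i(c)$ if $\varepsilon'_i(b)\le\varphi'_i(c)$ and $=e'_i(b)\otimes c$ otherwise; $f'_i(b\otimes c)=b\otimes f'_i(c)$ if $\varepsilon'_i(b)<\varphi'_i(c)$ and $=f'_i(b)\otimes c$ otherwise (with $b\otimes0=0\otimes c=0$). If $\mathcal{B},\mathcal{C}$ are $\sqrt{\mathfrak{q}_n}$-crystals, then $\mathcal{B}\otimes\mathcal{C}$ is moreover a $\sqrt{\mathfrak{q}_n}$-crystal with $e'_{\overline1}(b\otimes c)=b\otimes e'_{\overline1}(c)$ and $f'_{\overline1}(b\otimes c)=b\otimes f'_{\overline1}(c)$ if $\operatorname{wt}(b)_1=\operatorname{wt}(b)_2=0$, and $e'_{\overline1}(b\otimes c)=e'_{\overline1}(b)\otimes c$, $f'_{\overline1}(b\otimes c)=f'_{\overline1}(b)\otimes c$ otherwise. Finally, for $\sqrt{\mathfrak{gl}_n}$-crystals (resp. $\sqrt{\mathfrak{q}_n}$-crystals) $\mathcal{B},\mathcal{C},\mathcal{D}$, the natural map $\mathcal{B}\otimes(\mathcal{C}\otimes\mathcal{D})\to(\mathcal{B}\otimes\mathcal{C})\otimes\mathcal{D}$,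 $b\otimes(c\otimes d)\mapsto(b\otimes c)\otimes d$, is an isomorphism of $\sqrt{\mathfrak{gl}_n}$-crystals (resp. $\sqrt{\mathfrak{q}_n}$-crystals).
   Context: Let $n\ge2$. A $\sqrt{\mathfrak{gl}_n}$-crystal is a set $\mathcal{B}$ with $\operatorname{wt}:\mathcal{B}\to\mathbb{N}^n$ and maps $e'_i,f'_i:\mathcal{B}\to\mathcal{B}\sqcup\{0\}$ for $i\in[n-1]$ ($0\notin\mathcal{B}$, and all maps send $0$ to $0$); set $\varepsilon'_i(b)=\sup\{k\ge0:(e'_i)^k(b)\ne0\}$, $\varphi'_i(b)=\sup\{k\ge0:(f'_i)^k(b)\ne0\}$. Require for all $i$ and $b,c\in\mathcal{B}$: (a) $\varepsilon'_i(b)+\varphi'_i(b)\in2\mathbb{N}$ and $\frac{\varphi'_i(b)-\varepsilon'_i(b)}2=\operatorname{wt}(b)_i-\operatorname{wt}(b)_{i+1}$; (b) $e'_i(b)=c$ iff $b=f'_i(c)$, in which case $\operatorname{wt}(c)-\operatorname{wt}(b)$ is $\mathbf{e}_i$ if $\varepsilon'_i(b)$ is even and $-\mathbf{e}_{i+1}$ if odd ($\mathbf{e}_j$ standard basis vectors). A $\sqrt{\mathfrak{q}_n}$-crystal is a $\sqrt{\mathfrak{gl}_n}$-crystal with extra maps $e'_{\overline1},f'_{\overline1}:\mathcal{B}\to\mathcal{B}\sqcup\{0\}$ (with $\varepsilon'_{\overline1},\varphi'_{\overline1}$ defined analogously) that commute with $e'_i,f'_i$ and preserve $\varepsilon'_i,\varphi'_i$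 (values unchanged when the image is nonzero) for $3\le i\le n-1$, such that (a) $\varepsilon'_{\overline1}(b)+\varphi'_{\overline1}(b)$ is $0$ if $\operatorname{wt}(b)_1=\operatorname{wt}(b)_2=0$ and $2$ otherwise; (b) $e'_{\overline1}(b)=c$ iff $b=f'_{\overline1}(c)$, in which case $\operatorname{wt}(c)-\operatorname{wt}(b)$ is $\mathbf{e}_1$ if $\varepsilon'_{\overline1}(b)=2$ and $-\mathbf{e}_2$ if $\varepsilon'_{\overline1}(b)=1$. An isomorphism of such crystals is a weight-preserving bijection commuting with all the operators $e'_i,f'_i$ (including $i=\overline1$ in the $\sqrt{\mathfrak{q}_n}$ case), i.e. a weight-preserving isomorphism of the labeled crystal graphs. *)

theory Defs
  imports Complex_Main "HOL-Library.Extended_Nat"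
begin

text \<open>
  The codomain \<open>B \<squnion> {0}\<close> of a crystal operator is rendered by the option type,
  with \<open>None\<close> in the role of \<open>0\<close>; operators are extended to send \<open>0\<close> to \<open>0\<close> by
  \<^const>\<open>Option.bind\<close>.
\<close>

definition iter_op :: "('a \<Rightarrow> 'a option) \<Rightarrow> nat \<Rightarrow> 'a \<Rightarrow> 'a option" where
  "iter_op g k b = ((\<lambda>x. Option.bind x g) ^^ k) (Some b)"

definition string_length :: "('a \<Rightarrow> 'a option) \<Rightarrow> 'a \<Rightarrow> enat" where
  "string_length g b = Sup {enat k | k. iter_op g k b \<noteq> None}"

definition unit_vec :: "nat \<Rightarrow> nat \<Rightarrow> int" where
  "unit_vec i = (\<lambda>j. if j = i then 1 else 0)"

definition wt_diff :: "(nat \<Rightarrow> nat) \<Rightarrow> (nat \<Rightarrow> nat) \<Rightarrow> nat \<Rightarrow> int" where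
  "wt_diff x y = (\<lambda>j. int (x j) - int (y j))"

text \<open>
  A weight in \<open>\<nat>\<^sup>n\<close> is a function on \<^typ>\<open>nat\<close> vanishing outside \<open>{1..n}\<close>
  (enforced by the axiom \<open>wt_supp\<close> below). The values of the operators matter only on
  the underlying set and, for \<open>e_op\<close> and \<open>f_op\<close>, at indices in \<open>{1..n - 1}\<close>.
\<close>

record 'a gl_data =
  elems :: "'a set"
  wt :: "'a \<Rightarrow> nat \<Rightarrow> nat"
  e_op :: "nat \<Rightarrow> 'a \<Rightarrow> 'a option"
  f_op :: "nat \<Rightarrow> 'a \<Rightarrow> 'a option"

record 'a q_data = "'a gl_data" +
  ebar_op :: "'a \<Rightarrow> 'a option"
  fbar_op :: "'a \<Rightarrow> 'a option"

definition eps :: "('a, 'm) gl_data_scheme \<Rightarrow> nat \<Rightarrow> 'a \<Rightarrow> enat" where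
  "eps B i = string_length (e_op B i)"

definition phi :: "('a, 'm) gl_data_scheme \<Rightarrow> nat \<Rightarrow> 'a \<Rightarrow> enat" where
  "phi B i = string_length (f_op B i)"

definition eps_bar :: "('a, 'm) q_data_scheme \<Rightarrow> 'a \<Rightarrow> enat" where
  "eps_bar B = string_length (ebar_op B)"

definition phi_bar :: "('a, 'm) q_data_scheme \<Rightarrow> 'a \<Rightarrow> enat" where
  "phi_bar B = string_length (fbar_op B)"

text \<open>
  The first axiom \<open>string_even\<close> forces both string lengths to be finite, so that the uses
  of \<^const>\<open>the_enat\<close> in the later axioms are meaningful.
\<close>

locale sqrt_gl_crystal =
  fixes n :: nat and B :: "('a, 'm) gl_data_scheme"
  assumes wt_supp: "\<And>b j. b \<in> elems B \<Longrightarrow> j \<notin> {1..n} \<Longrightarrow> wt B b j = 0"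
    and e_closed: "\<And>i b c. i \<in> {1..n - 1} \<Longrightarrow> b \<in> elems B \<Longrightarrow> e_op B i b = Some c \<Longrightarrow> c \<in> elems B"
    and f_closed: "\<And>i b c. i \<in> {1..n - 1} \<Longrightarrow> b \<in> elems B \<Longrightarrow> f_op B i b = Some c \<Longrightarrow> c \<in> elems B"
    and string_even: "\<And>i b. i \<in> {1..n - 1} \<Longrightarrow> b \<in> elems B \<Longrightarrow>
      \<exists>m::nat. eps B i b + phi B i b = enat (2 * m)"
    and string_wt: "\<And>i b. i \<in> {1..n - 1} \<Longrightarrow> b \<in> elems B \<Longrightarrow>
      (real (the_enat (phi B i b)) - real (the_enat (eps B i b))) / 2
        = real (wt B b i) - real (wt B b (i + 1))"
    and e_iff_f: "\<And>i b c. i \<in> {1..n - 1} \<Longrightarrow> b \<in> elems B \<Longrightarrow> c \<in> elems B \<Longrightarrow>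
      e_op B i b = Some c \<longleftrightarrow> f_op B i c = Some b"
    and e_wt: "\<And>i b c. i \<in> {1..n - 1} \<Longrightarrow> b \<in> elems B \<Longrightarrow> c \<in> elems B \<Longrightarrow>
      e_op B i b = Some c \<Longrightarrow>
      wt_diff (wt B c) (wt B b)
        = (if even (the_enat (eps B i b)) then unit_vec i else - unit_vec (i + 1))"

definition ops_commute :: "'a set \<Rightarrow> ('a \<Rightarrow> 'a option) \<Rightarrow> ('a \<Rightarrow> 'a option) \<Rightarrow> bool" where
  "ops_commute S g h \<longleftrightarrow> (\<forall>b\<in>S. Option.bind (h b) g = Option.bind (g b) h)"

definition preserves :: "'a set \<Rightarrow> ('a \<Rightarrow> 'a option) \<Rightarrow> ('a \<Rightarrow> enat) \<Rightarrow> bool" where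
  "preserves S g s \<longleftrightarrow> (\<forall>b\<in>S. \<forall>c. g b = Some c \<longrightarrow> s c = s b)"

locale sqrt_q_crystal = sqrt_gl_crystal n B
  for n :: nat and B :: "('a, 'm) q_data_scheme" +
  assumes ebar_closed: "\<And>b c. b \<in> elems B \<Longrightarrow> ebar_op B b = Some c \<Longrightarrow> c \<in> elems B"
    and fbar_closed: "\<And>b c. b \<in> elems B \<Longrightarrow> fbar_op B b = Some c \<Longrightarrow> c \<in> elems B"
    and bar_commute: "\<And>i g h. i \<in> {3..n - 1} \<Longrightarrow> g \<in> {ebar_op B, fbar_op B} \<Longrightarrow>
      h \<in> {e_op B i, f_op B i} \<Longrightarrow> ops_commute (elems B) g h"
    and bar_preserves: "\<And>i g s. i \<in> {3..n - 1} \<Longrightarrow> g \<in> {ebar_op B, fbar_op B} \<Longrightarrow>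
      s \<in> {eps B i, phi B i} \<Longrightarrow> preserves (elems B) g s"
    and bar_string: "\<And>b. b \<in> elems B \<Longrightarrow>
      eps_bar B b + phi_bar B b = (if wt B b 1 = 0 \<and> wt B b 2 = 0 then 0 else 2)"
    and ebar_iff_fbar: "\<And>b c. b \<in> elems B \<Longrightarrow> c \<in> elems B \<Longrightarrow>
      ebar_op B b = Some c \<longleftrightarrow> fbar_op B c = Some b"
    and ebar_wt_2: "\<And>b c. b \<in> elems B \<Longrightarrow> c \<in> elems B \<Longrightarrow> ebar_op B b = Some c \<Longrightarrow>
      eps_bar B b = 2 \<Longrightarrow> wt_diff (wt B c) (wt B b) = unit_vec 1"
    and ebar_wt_1: "\<And>b c. b \<in> elems B \<Longrightarrow> c \<in> elems B \<Longrightarrow> ebar_op B b = Some c \<Longrightarrow>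
      eps_bar B b = 1 \<Longrightarrow> wt_diff (wt B c) (wt B b) = - unit_vec 2"

text \<open>
  The element \<open>b \<otimes> c\<close> is the pair \<open>(b, c)\<close>. The following two functions implement
  \<open>b \<otimes> x\<close> and \<open>x \<otimes> c\<close> when \<open>x\<close> may be \<open>0\<close>.
\<close>

definition tensor_right :: "'a \<Rightarrow> 'b option \<Rightarrow> ('a \<times> 'b) option" where
  "tensor_right b x = map_option (\<lambda>c. (b, c)) x"

definition tensor_left :: "'a option \<Rightarrow> 'b \<Rightarrow> ('a \<times> 'b) option" where
  "tensor_left x c = map_option (\<lambda>b. (b, c)) x"

definition gl_tensor ::
  "('a, 'm) gl_data_scheme \<Rightarrow> ('b, 'k) gl_data_scheme \<Rightarrow> ('a \<times> 'b) gl_data" where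
  "gl_tensor B C = \<lparr>
     elems = elems B \<times> elems C,
     wt = (\<lambda>(b, c) j. wt B b j + wt C c j),
     e_op = (\<lambda>i (b, c). if eps B i b \<le> phi C i c then tensor_right b (e_op C i c)
                         else tensor_left (e_op B i b) c),
     f_op = (\<lambda>i (b, c). if eps B i b < phi C i c then tensor_right b (f_op C i c)
                         else tensor_left (f_op B i b) c)\<rparr>"

definition q_tensor ::
  "('a, 'm) q_data_scheme \<Rightarrow> ('b, 'k) q_data_scheme \<Rightarrow> ('a \<times> 'b) q_data" where
  "q_tensor B C = gl_data.extend (gl_tensor B C) (q_data.fields
     (\<lambda>(b, c). if wt B b 1 = 0 \<and> wt B b 2 = 0 then tensor_right b (ebar_op C c)
                else tensor_left (ebar_op B b) c)
     (\<lambda>(b, c). if wt B b 1 = 0 \<and> wt B b 2 = 0 then tensor_right b (fbar_op C c)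
                else tensor_left (fbar_op B b) c))"

definition gl_isomorphism ::
  "nat \<Rightarrow> ('a \<Rightarrow> 'b) \<Rightarrow> ('a, 'm) gl_data_scheme \<Rightarrow> ('b, 'k) gl_data_scheme \<Rightarrow> bool" where
  "gl_isomorphism n F B C \<longleftrightarrow>
     sqrt_gl_crystal n B \<and> sqrt_gl_crystal n C \<and>
     bij_betw F (elems B) (elems C) \<and>
     (\<forall>b\<in>elems B. wt C (F b) = wt B b) \<and>
     (\<forall>i\<in>{1..n - 1}. \<forall>b\<in>elems B.
        e_op C i (F b) = map_option F (e_op B i b) \<and>
        f_op C i (F b) = map_option F (f_op B i b))"

definition q_isomorphism ::
  "nat \<Rightarrow> ('a \<Rightarrow> 'b) \<Rightarrow> ('a, 'm) q_data_scheme \<Rightarrow> ('b, 'k) q_data_scheme \<Rightarrow> bool" where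
  "q_isomorphism n F B C \<longleftrightarrow>
     sqrt_q_crystal n B \<and> sqrt_q_crystal n C \<and>
     gl_isomorphism n F B C \<and>
     (\<forall>b\<in>elems B.
        ebar_op C (F b) = map_option F (ebar_op B b) \<and>
        fbar_op C (F b) = map_option F (fbar_op B b))"

definition assoc_map :: "'a \<times> ('b \<times> 'c) \<Rightarrow> ('a \<times> 'b) \<times> 'c" where
  "assoc_map = (\<lambda>(b, (c, d)). ((b, c), d))"

end

theory Submission
  imports Defs
begin

text \<open>
  Everything follows from the signature rule: acting on \<open>b \<otimes> c\<close>, the operators cancel
  \<open>\<epsilon>\<^sub>i(b)\<close> against \<open>\<phi>\<^sub>i(c)\<close>, so that
  \<open>\<epsilon>\<^sub>i(b \<otimes> c) = \<epsilon>\<^sub>i(c) + max(0, \<epsilon>\<^sub>i(b) - \<phi>\<^sub>i(c))\<close> and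
  \<open>\<phi>\<^sub>i(b \<otimes> c) = \<phi>\<^sub>i(b) + max(0, \<phi>\<^sub>i(c) - \<epsilon>\<^sub>i(b))\<close>.
  For the barred operators, the length of the string through \<open>b\<close> decides whether
  \<open>wt(b)\<^sub>1 = wt(b)\<^sub>2 = 0\<close>; hence that condition is constant along strings and the
  string of \<open>b \<otimes> c\<close> is a copy of the string of one fixed factor.
\<close>

section \<open>Iterates and string lengths of partial maps\<close>

lemma iter_op_0 [simp]: "iter_op g 0 b = Some b"
  by (simp add: iter_op_def)

lemma iter_op_Suc: "iter_op g (Suc k) b = Option.bind (iter_op g k b) g"
  by (simp add: iter_op_def)

text \<open>Peels off the first application instead of the last, so that the string through an
  element can be compared with the string through its image.\<close>

lemma iter_op_Suc_left: "iter_op g (Suc k) b = Option.bind (g b) (iter_op g k)"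
  by (induction k) (cases "g b"; simp add: iter_op_Suc)+

lemma string_length_None:
  assumes "g b = None"
  shows "string_length g b = 0"
proof -
  have "iter_op g k b \<noteq> None \<longleftrightarrow> k = 0" for k
    using assms by (cases k) (simp_all add: iter_op_Suc_left)
  then have "{enat k |k. iter_op g k b \<noteq> None} = {0}"
    by (auto simp: zero_enat_def)
  then show ?thesis
    by (simp add: string_length_def)
qed

lemma string_length_Some:
  assumes "g b = Some c"
  shows "string_length g b = eSuc (string_length g c)"
proof -
  let ?S = "\<lambda>x. {enat k |k. iter_op g k x \<noteq> None}"
  have step: "iter_op g (Suc k) b = iter_op g k c" for k
    using assms by (simp add: iter_op_Suc_left)
  have "?S b = insert 0 (eSuc ` ?S c)"
  proof (intro set_eqI iffI)
    fix x assume "x \<in> ?S b"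
    then obtain k where k: "x = enat k" "iter_op g k b \<noteq> None" by blast
    show "x \<in> insert 0 (eSuc ` ?S c)"
    proof (cases k)
      case 0
      then show ?thesis using k by (simp add: zero_enat_def)
    next
      case (Suc l)
      then have "enat l \<in> ?S c" "x = eSuc (enat l)"
        using k step by (auto simp: eSuc_enat)
      then show ?thesis by blast
    qed
  next
    fix x assume "x \<in> insert 0 (eSuc ` ?S c)"
    then consider "x = enat 0" | k where "x = enat (Suc k)" "iter_op g k c \<noteq> None"
      by (auto simp: zero_enat_def eSuc_enat)
    then show "x \<in> ?S b"
      by cases (use step in \<open>fastforce+\<close>)
  qed
  \<comment> \<open>\<open>eSuc\<close> commutes with \<open>Sup\<close> only on nonempty sets,
    because the supremum of the empty set is 0. The inserted 0 is the bottom of \<open>enat\<close>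
    and does not change the supremum.\<close>
  moreover have "?S c \<noteq> {}"
    by (auto intro: exI[of _ 0])
  ultimately show ?thesis
    by (simp add: string_length_def eSuc_Sup flip: bot_enat_def)
qed

lemma string_length_eq_0_iff: "string_length g b = 0 \<longleftrightarrow> g b = None"
  by (cases "g b") (simp_all add: string_length_None string_length_Some)

text \<open>On an invariant set \<open>S\<close>, intertwining passes to all iterates by induction,
  and \<open>map_option\<close> keeps \<open>None\<close> apart from \<open>Some\<close>. This
  serves to transport barred strings from a factor to the tensor product.\<close>

lemma string_length_map:
  assumes comm: "\<And>x. x \<in> S \<Longrightarrow> h (F x) = map_option F (g x)"
    and closed: "\<And>x y. x \<in> S \<Longrightarrow> g x = Some y \<Longrightarrow> y \<in> S"
    and "b \<in> S"
  shows "string_length h (F b) = string_length g b"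
proof -
  have "iter_op h k (F b) = map_option F (iter_op g k b)" for k
    using \<open>b \<in> S\<close>
  proof (induction k arbitrary: b)
    case (Suc k)
    then show ?case
      using comm closed by (cases "g b") (auto simp: iter_op_Suc_left)
  qed simp
  then show ?thesis
    by (simp add: string_length_def)
qed

section \<open>Strings in a crystal\<close>

context sqrt_gl_crystal
begin

lemma eps_eq_0_iff: "eps B i b = 0 \<longleftrightarrow> e_op B i b = None"
  by (simp add: eps_def string_length_eq_0_iff)

lemma phi_eq_0_iff: "phi B i b = 0 \<longleftrightarrow> f_op B i b = None"
  by (simp add: phi_def string_length_eq_0_iff)

text \<open>The step changes both string lengths by one: \<open>eps\<close> by following
  \<open>e_op\<close> from \<open>b\<close>, and \<open>phi\<close> because \<open>f_op\<close>
  leads from \<open>c\<close> back to \<open>b\<close>.\<close>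

lemma e_op_SomeD:
  assumes "i \<in> {1..n - 1}" "b \<in> elems B" "e_op B i b = Some c"
  shows "c \<in> elems B" "f_op B i c = Some b"
    "eps B i b = eSuc (eps B i c)" "phi B i c = eSuc (phi B i b)"
proof -
  show c: "c \<in> elems B" using assms e_closed by blast
  show f: "f_op B i c = Some b" using assms c e_iff_f by blast
  show "eps B i b = eSuc (eps B i c)" "phi B i c = eSuc (phi B i b)"
    using assms f by (simp_all add: eps_def phi_def string_length_Some)
qed

lemma f_op_SomeD:
  assumes "i \<in> {1..n - 1}" "b \<in> elems B" "f_op B i b = Some c"
  shows "c \<in> elems B" "e_op B i c = Some b"
    "phi B i b = eSuc (phi B i c)" "eps B i c = eSuc (eps B i b)"
proof -
  show c: "c \<in> elems B" using assms f_closed by blast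
  show e: "e_op B i c = Some b" using assms c e_iff_f by blast
  show "phi B i b = eSuc (phi B i c)" "eps B i c = eSuc (eps B i b)"
    using e_op_SomeD[OF assms(1) c e] by simp_all
qed

text \<open>A finite sum in \<open>enat\<close> has finite summands. From here on string lengths can
  be handled by arithmetic on natural numbers.\<close>

lemma string_nat:
  assumes "i \<in> {1..n - 1}" "b \<in> elems B"
  obtains k l where "eps B i b = enat k" "phi B i b = enat l" "even (k + l)"
    "(real l - real k) / 2 = real (wt B b i) - real (wt B b (i + 1))"
proof -
  obtain m where m: "eps B i b + phi B i b = enat (2 * m)"
    using string_even[OF assms] by blast
  then obtain k l where kl: "eps B i b = enat k" "phi B i b = enat l"
    by (cases "eps B i b"; cases "phi B i b") auto
  moreover from m kl have "k + l = 2 * m" by simp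
  then have "even (k + l)" by simp
  moreover have "(real l - real k) / 2 = real (wt B b i) - real (wt B b (i + 1))"
    using string_wt[OF assms] kl by simp
  ultimately show ?thesis by (rule that)
qed

text \<open>The weight axiom moves a single coordinate, either i or i + 1. For i \<ge> 3 this will
  leave coordinates 1 and 2 alone.\<close>

lemma e_op_wt_other:
  assumes "i \<in> {1..n - 1}" "b \<in> elems B" "e_op B i b = Some c" "j \<noteq> i" "j \<noteq> i + 1"
  shows "wt B c j = wt B b j"
  using fun_cong[OF e_wt[OF assms(1,2) e_op_SomeD(1)[OF assms(1-3)] assms(3)], of j] assms(4,5)
  by (auto simp: wt_diff_def unit_vec_def split: if_splits)

lemma f_op_wt_other:
  assumes "i \<in> {1..n - 1}" "b \<in> elems B" "f_op B i b = Some c" "j \<noteq> i" "j \<noteq> i + 1"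
  shows "wt B c j = wt B b j"
  using e_op_wt_other[OF assms(1) f_op_SomeD(1,2)[OF assms(1-3)] assms(4,5)] by simp

end

section \<open>Tensor products\<close>

lemma tensor_simps [simp]:
  "tensor_right b None = None" "tensor_right b (Some c) = Some (b, c)"
  "tensor_left None c = None" "tensor_left (Some b) c = Some (b, c)"
  by (simp_all add: tensor_right_def tensor_left_def)

lemma tensor_eq_Some_iff:
  "tensor_right b x = Some p \<longleftrightarrow> (\<exists>c. x = Some c \<and> p = (b, c))"
  "tensor_left y c = Some p \<longleftrightarrow> (\<exists>b. y = Some b \<and> p = (b, c))"
  by (auto simp: tensor_right_def tensor_left_def)

lemma gl_tensor_simps [simp]:
  "elems (gl_tensor B C) = elems B \<times> elems C"
  "wt (gl_tensor B C) (b, c) = (\<lambda>j. wt B b j + wt C c j)"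
  "e_op (gl_tensor B C) i (b, c) =
    (if eps B i b \<le> phi C i c then tensor_right b (e_op C i c) else tensor_left (e_op B i b) c)"
  "f_op (gl_tensor B C) i (b, c) =
    (if eps B i b < phi C i c then tensor_right b (f_op C i c) else tensor_left (f_op B i b) c)"
  by (simp_all add: gl_tensor_def)

locale gl_crystal_pair = L: sqrt_gl_crystal n B + R: sqrt_gl_crystal n C
  for n :: nat and B :: "('a, 'm) gl_data_scheme" and C :: "('b, 'k) gl_data_scheme"
begin

text \<open>Truncated subtraction expresses the maximum with 0. Each step of the operator lowers the
  right-hand side by one: acting on \<open>c\<close> lowers \<open>eps C i c\<close> while the
  difference stays 0, and acting on \<open>b\<close> lowers the positive difference. The induction
  measure drops by one in either case.\<close>

lemma eps_gl_tensor:
  assumes "i \<in> {1..n - 1}" "b \<in> elems B" "c \<in> elems C"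
  shows "eps (gl_tensor B C) i (b, c) = eps C i c + (eps B i b - phi C i c)"
  using assms(2,3)
proof (induction "the_enat (eps B i b) + the_enat (eps C i c)" arbitrary: b c rule: less_induct)
  case less
  obtain x x' where x: "eps B i b = enat x" "phi B i b = enat x'"
    using L.string_nat[OF assms(1) less.prems(1)] .
  obtain y z where y: "eps C i c = enat y" "phi C i c = enat z"
    using R.string_nat[OF assms(1) less.prems(2)] .
  show ?case
  proof (cases "e_op (gl_tensor B C) i (b, c)")
    case None
    then have "eps (gl_tensor B C) i (b, c) = 0"
      by (simp add: eps_def string_length_None)
    \<comment> \<open>If x \<le> z, the operator kills \<open>c\<close>, so y = 0. The case x > z
      cannot occur, since killing \<open>b\<close> would give x = 0.\<close>
    moreover have "y + (x - z) = 0"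
      using None x y L.eps_eq_0_iff[of i b] R.eps_eq_0_iff[of i c]
      by (auto simp: zero_enat_def tensor_right_def tensor_left_def split: if_splits)
    ultimately show ?thesis
      using x y by (simp add: zero_enat_def)
  next
    case (Some p)
    then have rec: "eps (gl_tensor B C) i (b, c) = eSuc (eps (gl_tensor B C) i p)"
      by (simp add: eps_def string_length_Some)
    show ?thesis
    proof (cases "x \<le> z")
      case True
      then obtain c' where c': "e_op C i c = Some c'" "p = (b, c')"
        using Some x y by (auto simp: tensor_eq_Some_iff)
      note D = R.e_op_SomeD[OF assms(1) less.prems(2) c'(1)]
      obtain y' z' where y': "eps C i c' = enat y'" "phi C i c' = enat z'"
        using R.string_nat[OF assms(1) D(1)] .
      have eqs: "y = Suc y'" "z' = Suc z"
        using D(3,4) y y' by (simp_all add: eSuc_enat)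
      have "eps (gl_tensor B C) i (b, c') = eps C i c' + (eps B i b - phi C i c')"
        using less.hyps[of b c'] less.prems D(1) x y y' eqs by simp
      then show ?thesis
        using rec c' x y y' eqs True by (simp add: eSuc_enat)
    next
      case False
      then obtain b' where b': "e_op B i b = Some b'" "p = (b', c)"
        using Some x y by (auto simp: tensor_eq_Some_iff)
      note D = L.e_op_SomeD[OF assms(1) less.prems(1) b'(1)]
      obtain u u' where u: "eps B i b' = enat u" "phi B i b' = enat u'"
        using L.string_nat[OF assms(1) D(1)] .
      have eqs: "x = Suc u"
        using D(3) x u by (simp add: eSuc_enat)
      have "eps (gl_tensor B C) i (b', c) = eps C i c + (eps B i b' - phi C i c)"
        using less.hyps[of b' c] less.prems D(1) x y u eqs by simp
      then show ?thesis
        using rec b' x y u eqs False by (simp add: eSuc_enat)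
    qed
  qed
qed

text \<open>The mirror image of \<open>eps_gl_tensor\<close>: acting on \<open>c\<close> lowers the
  positive difference, while acting on \<open>b\<close> lowers \<open>phi B i b\<close> and raises
  \<open>eps B i b\<close>, so the difference stays 0.\<close>

lemma phi_gl_tensor:
  assumes "i \<in> {1..n - 1}" "b \<in> elems B" "c \<in> elems C"
  shows "phi (gl_tensor B C) i (b, c) = phi B i b + (phi C i c - eps B i b)"
  using assms(2,3)
proof (induction "the_enat (phi B i b) + the_enat (phi C i c)" arbitrary: b c rule: less_induct)
  case less
  obtain x x' where x: "eps B i b = enat x" "phi B i b = enat x'"
    using L.string_nat[OF assms(1) less.prems(1)] .
  obtain y z where y: "eps C i c = enat y" "phi C i c = enat z"
    using R.string_nat[OF assms(1) less.prems(2)] .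
  show ?case
  proof (cases "f_op (gl_tensor B C) i (b, c)")
    case None
    then have "phi (gl_tensor B C) i (b, c) = 0"
      by (simp add: phi_def string_length_None)
    moreover have "x' + (z - x) = 0"
      using None x y L.phi_eq_0_iff[of i b] R.phi_eq_0_iff[of i c]
      by (auto simp: zero_enat_def tensor_right_def tensor_left_def split: if_splits)
    ultimately show ?thesis
      using x y by (simp add: zero_enat_def)
  next
    case (Some p)
    then have rec: "phi (gl_tensor B C) i (b, c) = eSuc (phi (gl_tensor B C) i p)"
      by (simp add: phi_def string_length_Some)
    show ?thesis
    proof (cases "x < z")
      case True
      then obtain c' where c': "f_op C i c = Some c'" "p = (b, c')"
        using Some x y by (auto simp: tensor_eq_Some_iff)
      note D = R.f_op_SomeD[OF assms(1) less.prems(2) c'(1)]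
      obtain y' z' where y': "eps C i c' = enat y'" "phi C i c' = enat z'"
        using R.string_nat[OF assms(1) D(1)] .
      have eqs: "z = Suc z'"
        using D(3) y y' by (simp add: eSuc_enat)
      have "phi (gl_tensor B C) i (b, c') = phi B i b + (phi C i c' - eps B i b)"
        using less.hyps[of b c'] less.prems D(1) x y y' eqs by simp
      then show ?thesis
        using rec c' x y y' eqs True by (simp add: eSuc_enat)
    next
      case False
      then obtain b' where b': "f_op B i b = Some b'" "p = (b', c)"
        using Some x y by (auto simp: tensor_eq_Some_iff)
      note D = L.f_op_SomeD[OF assms(1) less.prems(1) b'(1)]
      obtain u u' where u: "eps B i b' = enat u" "phi B i b' = enat u'"
        using L.string_nat[OF assms(1) D(1)] .
      have eqs: "x' = Suc u'" "u = Suc x"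
        using D(3,4) x u by (simp_all add: eSuc_enat)
      have "phi (gl_tensor B C) i (b', c) = phi B i b' + (phi C i c - eps B i b')"
        using less.hyps[of b' c] less.prems D(1) x y u eqs by simp
      then show ?thesis
        using rec b' x y u eqs False by (simp add: eSuc_enat)
    qed
  qed
qed

text \<open>The weak inequality for e and the strict one for f fit together: a step of e on
  \<open>c\<close> raises \<open>phi\<close> of that factor by one, and a step of e on
  \<open>b\<close> lowers \<open>eps\<close> of that factor by one. Hence f, applied to the result,
  selects the same factor.\<close>

lemma e_iff_f_gl_tensor:
  assumes i: "i \<in> {1..n - 1}"
    and bc: "b \<in> elems B" "c \<in> elems C" and bc': "b' \<in> elems B" "c' \<in> elems C"
  shows "e_op (gl_tensor B C) i (b, c) = Some (b', c') \<longleftrightarrow>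
    f_op (gl_tensor B C) i (b', c') = Some (b, c)" (is "?e \<longleftrightarrow> ?f")
proof
  assume e: ?e
  show ?f
  proof (cases "eps B i b \<le> phi C i c")
    case True
    then have *: "e_op C i c = Some c'" "b' = b"
      using e by (auto simp: tensor_eq_Some_iff)
    \<comment> \<open>Finiteness matters here: the passage from \<le> to < a successor fails at
      infinity.\<close>
    have "eps B i b < phi C i c'"
      using True R.e_op_SomeD(4)[OF i bc(2) *(1)] L.string_nat[OF i bc(1)] R.string_nat[OF i bc(2)]
      by (metis eSuc_enat enat_ord_simps(1,2) le_imp_less_Suc)
    then show ?thesis
      using * R.e_op_SomeD(2)[OF i bc(2) *(1)] by simp
  next
    case False
    then have *: "e_op B i b = Some b'" "c' = c"
      using e by (auto simp: tensor_eq_Some_iff)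
    have "\<not> eps B i b' < phi C i c"
      using False L.e_op_SomeD(3)[OF i bc(1) *(1)] by (metis ileI1)
    then show ?thesis
      using * L.e_op_SomeD(2)[OF i bc(1) *(1)] by simp
  qed
next
  assume f: ?f
  show ?e
  proof (cases "eps B i b' < phi C i c'")
    case True
    then have *: "f_op C i c' = Some c" "b' = b"
      using f by (auto simp: tensor_eq_Some_iff)
    have "eps B i b \<le> phi C i c"
      using True R.f_op_SomeD(3)[OF i bc'(2) *(1)] *(2) by (metis eSuc_ile_mono ileI1)
    then show ?thesis
      using * R.f_op_SomeD(2)[OF i bc'(2) *(1)] by simp
  next
    case False
    then have *: "f_op B i b' = Some b" "c' = c"
      using f by (auto simp: tensor_eq_Some_iff)
    have "\<not> eps B i b \<le> phi C i c"
      using False L.f_op_SomeD(4)[OF i bc'(1) *(1)] *(2)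
        L.string_nat[OF i bc'(1)] R.string_nat[OF i bc(2)]
      by (metis Suc_ile_eq eSuc_enat)
    then show ?thesis
      using * L.f_op_SomeD(2)[OF i bc'(1) *(1)] by simp
  qed
qed

lemma e_wt_gl_tensor:
  assumes i: "i \<in> {1..n - 1}" and bc: "b \<in> elems B" "c \<in> elems C"
    and e: "e_op (gl_tensor B C) i (b, c) = Some (b', c')"
  shows "wt_diff (wt (gl_tensor B C) (b', c')) (wt (gl_tensor B C) (b, c))
    = (if even (the_enat (eps (gl_tensor B C) i (b, c))) then unit_vec i else - unit_vec (i + 1))"
proof -
  obtain x x' where x: "eps B i b = enat x" "phi B i b = enat x'"
    using L.string_nat[OF i bc(1)] .
  obtain y z where y: "eps C i c = enat y" "phi C i c = enat z" "even (y + z)"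
    using R.string_nat[OF i bc(2)] .
  have eps: "the_enat (eps (gl_tensor B C) i (b, c)) = y + (x - z)"
    using eps_gl_tensor[OF i bc] x y by simp
  show ?thesis
  proof (cases "x \<le> z")
    case True
    then have *: "e_op C i c = Some c'" "b' = b"
      using e x y by (auto simp: tensor_eq_Some_iff)
    have "wt_diff (wt (gl_tensor B C) (b', c')) (wt (gl_tensor B C) (b, c))
        = wt_diff (wt C c') (wt C c)"
      using * by (simp add: wt_diff_def)
    then show ?thesis
      using R.e_wt[OF i bc(2) R.e_op_SomeD(1)[OF i bc(2) *(1)] *(1)] y True eps by simp
  next
    case False
    then have *: "e_op B i b = Some b'" "c' = c"
      using e x y by (auto simp: tensor_eq_Some_iff)
    have "wt_diff (wt (gl_tensor B C) (b', c')) (wt (gl_tensor B C) (b, c))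
        = wt_diff (wt B b') (wt B b)"
      using * by (simp add: wt_diff_def)
    \<comment> \<open>The weight rule for \<open>B\<close> refers to the parity of x. It agrees with
      the parity for the product because y + z is even and x > z.\<close>
    moreover have "even (y + (x - z)) \<longleftrightarrow> even x"
      using y(3) False by presburger
    ultimately show ?thesis
      using L.e_wt[OF i bc(1) L.e_op_SomeD(1)[OF i bc(1) *(1)] *(1)] x eps by simp
  qed
qed

sublocale tensor: sqrt_gl_crystal n "gl_tensor B C"
proof
  fix p j assume "p \<in> elems (gl_tensor B C)" "j \<notin> {1..n}"
  then show "wt (gl_tensor B C) p j = 0"
    using L.wt_supp R.wt_supp by (cases p) simp
next
  fix i p q assume "i \<in> {1..n - 1}" "p \<in> elems (gl_tensor B C)" "e_op (gl_tensor B C) i p = Some q"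
  then show "q \<in> elems (gl_tensor B C)"
    using L.e_closed R.e_closed by (cases p) (auto simp: tensor_eq_Some_iff split: if_splits)
next
  fix i p q assume "i \<in> {1..n - 1}" "p \<in> elems (gl_tensor B C)" "f_op (gl_tensor B C) i p = Some q"
  then show "q \<in> elems (gl_tensor B C)"
    using L.f_closed R.f_closed by (cases p) (auto simp: tensor_eq_Some_iff split: if_splits)
next
  fix i p assume i: "i \<in> {1..n - 1}" and "p \<in> elems (gl_tensor B C)"
  then obtain b c where p: "p = (b, c)" and bc: "b \<in> elems B" "c \<in> elems C"
    by (cases p) auto
  obtain x x' where x: "eps B i b = enat x" "phi B i b = enat x'" "even (x + x')"
    "(real x' - real x) / 2 = real (wt B b i) - real (wt B b (i + 1))"
    using L.string_nat[OF i bc(1)] .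
  obtain y z where y: "eps C i c = enat y" "phi C i c = enat z" "even (y + z)"
    "(real z - real y) / 2 = real (wt C c i) - real (wt C c (i + 1))"
    using R.string_nat[OF i bc(2)] .
  have val: "eps (gl_tensor B C) i p = enat (y + (x - z))"
    "phi (gl_tensor B C) i p = enat (x' + (z - x))"
    using eps_gl_tensor[OF i bc] phi_gl_tensor[OF i bc] x y p by simp_all
  \<comment> \<open>One of the two truncated differences is 0 and the other is the distance of x and
    z, so the sum has the parity of x + x' + y + z.\<close>
  have "even (y + (x - z) + (x' + (z - x)))"
    using x(3) y(3) by (cases "x \<le> z") (auto simp: even_diff_nat)
  then obtain m where "y + (x - z) + (x' + (z - x)) = 2 * m"
    by (elim evenE)
  then show "\<exists>m. eps (gl_tensor B C) i p + phi (gl_tensor B C) i p = enat (2 * m)"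
    unfolding val by (intro exI[of _ m]) simp
  \<comment> \<open>The two truncated differences combine to the true difference of z and x, which
    makes phi - eps additive, as the weight is.\<close>
  have "real (x' + (z - x)) - real (y + (x - z)) = (real x' - real x) + (real z - real y)"
    by (cases "x \<le> z") auto
  then show "(real (the_enat (phi (gl_tensor B C) i p)) - real (the_enat (eps (gl_tensor B C) i p))) / 2
      = real (wt (gl_tensor B C) p i) - real (wt (gl_tensor B C) p (i + 1))"
    unfolding val using x(4) y(4) p by (simp add: add_divide_distrib)
next
  fix i p q assume "i \<in> {1..n - 1}" "p \<in> elems (gl_tensor B C)" "q \<in> elems (gl_tensor B C)"
  then show "e_op (gl_tensor B C) i p = Some q \<longleftrightarrow> f_op (gl_tensor B C) i q = Some p"
    using e_iff_f_gl_tensor[of i "fst p" "snd p" "fst q" "snd q"] by auto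
next
  fix i p q assume "i \<in> {1..n - 1}" "p \<in> elems (gl_tensor B C)" "q \<in> elems (gl_tensor B C)"
    "e_op (gl_tensor B C) i p = Some q"
  then show "wt_diff (wt (gl_tensor B C) q) (wt (gl_tensor B C) p)
    = (if even (the_enat (eps (gl_tensor B C) i p)) then unit_vec i else - unit_vec (i + 1))"
    using e_wt_gl_tensor[of i "fst p" "snd p" "fst q" "snd q"] by auto
qed

end

lemma sqrt_gl_crystal_gl_tensor:
  assumes "sqrt_gl_crystal n B" "sqrt_gl_crystal n C"
  shows "sqrt_gl_crystal n (gl_tensor B C)"
proof -
  interpret gl_crystal_pair n B C
    using assms by (simp add: gl_crystal_pair_def)
  show ?thesis by (rule tensor.sqrt_gl_crystal_axioms)
qed

section \<open>Associativity\<close>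

lemma assoc_map_simps [simp]: "assoc_map (b, (c, d)) = ((b, c), d)"
  by (simp add: assoc_map_def)

text \<open>One equation for each of the three factors on which an operator may act.\<close>

lemma map_assoc_tensor [simp]:
  "map_option assoc_map (tensor_right b (tensor_right c x)) = tensor_right (b, c) x"
  "map_option assoc_map (tensor_right b (tensor_left y d)) = tensor_left (tensor_right b y) d"
  "map_option assoc_map (tensor_left z (c, d)) = tensor_left (tensor_left z c) d"
  by (cases x; cases y; cases z; simp)+

lemma bij_betw_assoc_map: "bij_betw assoc_map (A \<times> (B \<times> C)) ((A \<times> B) \<times> C)"
  by (rule bij_betw_byWitness[where f' = "\<lambda>((b, c), d). (b, (c, d))"]) auto

lemma gl_isomorphism_assoc_map:
  assumes "sqrt_gl_crystal n B" "sqrt_gl_crystal n C" "sqrt_gl_crystal n D"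
  shows "gl_isomorphism n assoc_map (gl_tensor B (gl_tensor C D)) (gl_tensor (gl_tensor B C) D)"
proof -
  interpret BC: gl_crystal_pair n B C using assms by (simp add: gl_crystal_pair_def)
  interpret CD: gl_crystal_pair n C D using assms by (simp add: gl_crystal_pair_def)
  have "e_op (gl_tensor (gl_tensor B C) D) i ((b, c), d) =
      map_option assoc_map (e_op (gl_tensor B (gl_tensor C D)) i (b, c, d)) \<and>
    f_op (gl_tensor (gl_tensor B C) D) i ((b, c), d) =
      map_option assoc_map (f_op (gl_tensor B (gl_tensor C D)) i (b, c, d))"
    if i: "i \<in> {1..n - 1}" and bcd: "b \<in> elems B" "c \<in> elems C" "d \<in> elems D" for i b c d
  proof -
    obtain x where x: "eps B i b = enat x" using BC.L.string_nat[OF i bcd(1)] .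
    obtain y z where y: "eps C i c = enat y" "phi C i c = enat z"
      using BC.R.string_nat[OF i bcd(2)] .
    obtain w where w: "phi D i d = enat w" using CD.R.string_nat[OF i bcd(3)] .
    show ?thesis
      \<comment> \<open>Both bracketings select the same factor. For e, the third is chosen iff y +
        (x - z) \<le> w on one side, and iff y \<le> w and x \<le> z + (w - y) on the other; these
        agree for truncated subtraction. Otherwise the second is chosen iff w < y and x \<le> z. For
        f the comparisons are those with \<le> replaced by <.\<close>
      by (auto simp: BC.eps_gl_tensor[OF i bcd(1,2)] CD.phi_gl_tensor[OF i bcd(2,3)] x y w)
  qed
  moreover have "sqrt_gl_crystal n (gl_tensor B (gl_tensor C D))"
      "sqrt_gl_crystal n (gl_tensor (gl_tensor B C) D)"
    using assms by (simp_all add: sqrt_gl_crystal_gl_tensor)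
  ultimately show ?thesis
    unfolding gl_isomorphism_def by (auto simp: bij_betw_assoc_map add.assoc)
qed

section \<open>The barred operators\<close>

definition wt_zero :: "('a, 'm) gl_data_scheme \<Rightarrow> 'a \<Rightarrow> bool" where
  "wt_zero B b \<longleftrightarrow> wt B b 1 = 0 \<and> wt B b 2 = 0"

lemma q_tensor_simps [simp]:
  "elems (q_tensor P Q) = elems P \<times> elems Q"
  "wt (q_tensor P Q) = wt (gl_tensor P Q)"
  "e_op (q_tensor P Q) = e_op (gl_tensor P Q)"
  "f_op (q_tensor P Q) = f_op (gl_tensor P Q)"
  "ebar_op (q_tensor P Q) (b, c) =
    (if wt_zero P b then tensor_right b (ebar_op Q c)
     else tensor_left (ebar_op P b) c)"
  "fbar_op (q_tensor P Q) (b, c) =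
    (if wt_zero P b then tensor_right b (fbar_op Q c)
     else tensor_left (fbar_op P b) c)"
  by (simp_all add: q_tensor_def gl_tensor_def gl_data.defs q_data.defs wt_zero_def)

text \<open>Weights are natural numbers, so a sum vanishes only if both summands do.\<close>

lemma wt_zero_q_tensor [simp]:
  "wt_zero (q_tensor P Q) (b, c) \<longleftrightarrow> wt_zero P b \<and> wt_zero Q c"
  by (auto simp: wt_zero_def)

lemma eps_phi_q_tensor [simp]:
  "eps (q_tensor P Q) = eps (gl_tensor P Q)" "phi (q_tensor P Q) = phi (gl_tensor P Q)"
  by (simp_all add: eps_def phi_def fun_eq_iff)

lemma sqrt_gl_crystal_q_tensor_iff:
  "sqrt_gl_crystal n (q_tensor P Q) \<longleftrightarrow> sqrt_gl_crystal n (gl_tensor P Q)"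
  by (simp add: sqrt_gl_crystal_def)

text \<open>\<open>gl_tensor\<close> reads only the unbarred fields. This reduces the unbarred half
  of associativity for \<open>q_tensor\<close> to that for \<open>gl_tensor\<close>.\<close>

lemma gl_tensor_q_tensor [simp]:
  "gl_tensor P (q_tensor Q R) = gl_tensor P (gl_tensor Q R)"
  "gl_tensor (q_tensor P Q) R = gl_tensor (gl_tensor P Q) R"
  by (simp_all add: gl_tensor_def[of P "q_tensor Q R"] gl_tensor_def[of P "gl_tensor Q R"]
      gl_tensor_def[of "q_tensor P Q" R] gl_tensor_def[of "gl_tensor P Q" R] cong: if_cong)

text \<open>Each selection condition is stable under the other operator, so each operator acts on
  the same factor before and after the other. On a common factor they commute by assumption, and on
  different factors they act independently.\<close>

lemma ops_commute_tensor:
  assumes comm: "ops_commute S g h" "ops_commute T g' h'"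
    and z: "\<And>b b'. b \<in> S \<Longrightarrow> h b = Some b' \<Longrightarrow> z b' \<longleftrightarrow> z b"
    and k: "\<And>b b' c. b \<in> S \<Longrightarrow> g b = Some b' \<Longrightarrow> k b' c \<longleftrightarrow> k b c"
      "\<And>b c c'. c \<in> T \<Longrightarrow> g' c = Some c' \<Longrightarrow> k b c' \<longleftrightarrow> k b c"
  shows "ops_commute (S \<times> T)
    (\<lambda>(b, c). if z b then tensor_right b (g' c) else tensor_left (g b) c)
    (\<lambda>(b, c). if k b c then tensor_right b (h' c) else tensor_left (h b) c)"
  unfolding ops_commute_def
proof (clarify)
  fix b c assume bc: "b \<in> S" "c \<in> T"
  have "Option.bind (h b) g = Option.bind (g b) h" "Option.bind (h' c) g' = Option.bind (g' c) h'"
    using comm bc by (auto simp: ops_commute_def)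
  then show "Option.bind (if k b c then tensor_right b (h' c) else tensor_left (h b) c)
      (\<lambda>(b, c). if z b then tensor_right b (g' c) else tensor_left (g b) c) =
    Option.bind (if z b then tensor_right b (g' c) else tensor_left (g b) c)
      (\<lambda>(b, c). if k b c then tensor_right b (h' c) else tensor_left (h b) c)"
    by (cases "g b"; cases "h b"; cases "g' c"; cases "h' c")
      (simp_all add: z[OF bc(1)] k(1)[OF bc(1)] k(2)[OF bc(2)])
qed

section \<open>Barred strings in a single crystal\<close>

context sqrt_q_crystal
begin

lemma bar_string_wt_zero:
  "b \<in> elems B \<Longrightarrow> eps_bar B b + phi_bar B b = (if wt_zero B b then 0 else 2)"
  using bar_string by (simp add: wt_zero_def)

text \<open>An arrow makes \<open>eps_bar\<close> at its source and \<open>phi_bar\<close> at its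
  target nonzero, so the string axiom excludes \<open>wt_zero\<close> at both ends.\<close>

lemma ebar_op_SomeD:
  assumes "b \<in> elems B" "ebar_op B b = Some c"
  shows "c \<in> elems B" "fbar_op B c = Some b" "\<not> wt_zero B b" "\<not> wt_zero B c"
proof -
  show c: "c \<in> elems B" using assms ebar_closed by blast
  show f: "fbar_op B c = Some b" using assms c ebar_iff_fbar by blast
  have "eps_bar B b \<noteq> 0" "phi_bar B c \<noteq> 0"
    using assms(2) f by (simp_all add: eps_bar_def phi_bar_def string_length_eq_0_iff)
  then show "\<not> wt_zero B b" "\<not> wt_zero B c"
    using bar_string_wt_zero[OF assms(1)] bar_string_wt_zero[OF c] by (auto split: if_splits)
qed

lemma fbar_op_SomeD:
  assumes "b \<in> elems B" "fbar_op B b = Some c"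
  shows "c \<in> elems B" "ebar_op B c = Some b" "\<not> wt_zero B b" "\<not> wt_zero B c"
proof -
  show c: "c \<in> elems B" using assms fbar_closed by blast
  show e: "ebar_op B c = Some b" using assms c ebar_iff_fbar by blast
  show "\<not> wt_zero B b" "\<not> wt_zero B c"
    using ebar_op_SomeD[OF c e] by simp_all
qed

lemma bar_eps_phi:
  assumes "i \<in> {3..n - 1}" "b \<in> elems B" "ebar_op B b = Some c \<or> fbar_op B b = Some c"
  shows "eps B i c = eps B i b" "phi B i c = phi B i b"
  using assms bar_preserves[OF assms(1), of "ebar_op B"] bar_preserves[OF assms(1), of "fbar_op B"]
  by (auto simp: preserves_def)

end

section \<open>Barred operators on tensor products\<close>

locale q_crystal_pair = L: sqrt_q_crystal n P + R: sqrt_q_crystal n Q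
  for n :: nat and P :: "('a, 'm) q_data_scheme" and Q :: "('b, 'k) q_data_scheme"
begin

sublocale gl_crystal_pair n P Q ..

lemma bar_string_q_tensor:
  assumes bc: "b \<in> elems P" "c \<in> elems Q"
  shows "eps_bar (q_tensor P Q) (b, c) = (if wt_zero P b then eps_bar Q c else eps_bar P b)"
    and "phi_bar (q_tensor P Q) (b, c) = (if wt_zero P b then phi_bar Q c else phi_bar P b)"
proof -
  \<comment> \<open>The barred operators of \<open>P\<close> stay inside this set, so the product
    keeps acting on the first factor. In the other case the first component \<open>b\<close> never
    changes, and the whole type serves as invariant set.\<close>
  let ?S = "{x \<in> elems P. \<not> wt_zero P x}"
  have zero: "string_length (ebar_op (q_tensor P Q)) (b, c) = string_length (ebar_op Q) c"
    "string_length (fbar_op (q_tensor P Q)) (b, c) = string_length (fbar_op Q) c"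
    if "wt_zero P b"
    using that
    by (auto intro!: string_length_map[where F = "Pair b" and S = UNIV] simp: tensor_right_def)
  have nonzero: "string_length (ebar_op (q_tensor P Q)) (b, c) = string_length (ebar_op P) b"
    "string_length (fbar_op (q_tensor P Q)) (b, c) = string_length (fbar_op P) b"
    if "\<not> wt_zero P b"
  proof -
    show "string_length (ebar_op (q_tensor P Q)) (b, c) = string_length (ebar_op P) b"
      by (rule string_length_map[where F = "\<lambda>x. (x, c)" and S = ?S])
        (use that bc L.ebar_op_SomeD in \<open>auto simp: tensor_left_def\<close>)
    show "string_length (fbar_op (q_tensor P Q)) (b, c) = string_length (fbar_op P) b"
      by (rule string_length_map[where F = "\<lambda>x. (x, c)" and S = ?S])
        (use that bc L.fbar_op_SomeD in \<open>auto simp: tensor_left_def\<close>)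
  qed
  show "eps_bar (q_tensor P Q) (b, c) = (if wt_zero P b then eps_bar Q c else eps_bar P b)"
    "phi_bar (q_tensor P Q) (b, c) = (if wt_zero P b then phi_bar Q c else phi_bar P b)"
    using zero nonzero by (auto simp: eps_bar_def phi_bar_def)
qed

text \<open>Here i \<ge> 3 enters: only coordinates i and i + 1 can change.\<close>

lemma wt_zero_op:
  assumes "i \<in> {3..n - 1}" "b \<in> elems P" "e_op P i b = Some b' \<or> f_op P i b = Some b'"
  shows "wt_zero P b' \<longleftrightarrow> wt_zero P b"
proof -
  have "i \<in> {1..n - 1}" using assms(1) by auto
  then show ?thesis
    using assms L.e_op_wt_other[of i b b'] L.f_op_wt_other[of i b b'] by (auto simp: wt_zero_def)
qed

lemma bar_commute_q_tensor:
  assumes i: "i \<in> {3..n - 1}"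
    and g: "g \<in> {ebar_op (q_tensor P Q), fbar_op (q_tensor P Q)}"
    and h: "h \<in> {e_op (q_tensor P Q) i, f_op (q_tensor P Q) i}"
  shows "ops_commute (elems (q_tensor P Q)) g h"
proof -
  \<comment> \<open>Writing both operators in a common shape treats all four pairs at once. Below,
    \<open>k\<close> is \<le> for e and < for f.\<close>
  obtain gP gQ where gPQ: "gP \<in> {ebar_op P, fbar_op P}" "gQ \<in> {ebar_op Q, fbar_op Q}"
    and g_eq: "g = (\<lambda>(b, c). if wt_zero P b then tensor_right b (gQ c) else tensor_left (gP b) c)"
  proof -
    from g consider "g = ebar_op (q_tensor P Q)" | "g = fbar_op (q_tensor P Q)" by blast
    then show thesis
    proof cases
      case 1
      then show ?thesis
        by (intro that[of "ebar_op P" "ebar_op Q"]) (auto simp: fun_eq_iff)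
    next
      case 2
      then show ?thesis
        by (intro that[of "fbar_op P" "fbar_op Q"]) (auto simp: fun_eq_iff)
    qed
  qed
  obtain hP hQ k where hPQ: "hP \<in> {e_op P i, f_op P i}" "hQ \<in> {e_op Q i, f_op Q i}"
    and h_eq: "h = (\<lambda>(b, c). if k (eps P i b) (phi Q i c) then tensor_right b (hQ c)
      else tensor_left (hP b) c)"
  proof -
    from h consider "h = e_op (q_tensor P Q) i" | "h = f_op (q_tensor P Q) i" by blast
    then show thesis
    proof cases
      case 1
      then show ?thesis
        by (intro that[of "e_op P i" "e_op Q i" "(\<le>)"]) (auto simp: fun_eq_iff)
    next
      case 2
      then show ?thesis
        by (intro that[of "f_op P i" "f_op Q i" "(<)"]) (auto simp: fun_eq_iff)
    qed
  qed
  show ?thesis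
    unfolding g_eq h_eq q_tensor_simps(1)
  proof (rule ops_commute_tensor[where k = "\<lambda>b c. k (eps P i b) (phi Q i c)"])
    show "ops_commute (elems P) gP hP" "ops_commute (elems Q) gQ hQ"
      using i gPQ hPQ L.bar_commute R.bar_commute by blast+
    show "wt_zero P b' \<longleftrightarrow> wt_zero P b" if "b \<in> elems P" "hP b = Some b'" for b b'
      using wt_zero_op[OF i that(1)] that hPQ by auto
    show "k (eps P i b') (phi Q i c) \<longleftrightarrow> k (eps P i b) (phi Q i c)"
      if "b \<in> elems P" "gP b = Some b'" for b b' c
      using L.bar_eps_phi[OF i that(1), of b'] that gPQ by auto
    show "k (eps P i b) (phi Q i c') \<longleftrightarrow> k (eps P i b) (phi Q i c)"
      if "c \<in> elems Q" "gQ c = Some c'" for b c c'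
      using R.bar_eps_phi[OF i that(1), of c'] that gPQ by auto
  qed
qed

text \<open>A barred operator changes one factor and preserves its string lengths, and the string
  lengths of the product depend only on those of the factors.\<close>

lemma bar_preserves_q_tensor:
  assumes i: "i \<in> {3..n - 1}" and bc: "b \<in> elems P" "c \<in> elems Q"
    and p: "ebar_op (q_tensor P Q) (b, c) = Some (b', c') \<or>
      fbar_op (q_tensor P Q) (b, c) = Some (b', c')"
  shows "eps (gl_tensor P Q) i (b', c') = eps (gl_tensor P Q) i (b, c)"
    and "phi (gl_tensor P Q) i (b', c') = phi (gl_tensor P Q) i (b, c)"
proof -
  have i1: "i \<in> {1..n - 1}" using i by auto
  have "b' \<in> elems P \<and> eps P i b' = eps P i b \<and> phi P i b' = phi P i b \<and>
    c' \<in> elems Q \<and> eps Q i c' = eps Q i c \<and> phi Q i c' = phi Q i c"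
    using p bc L.bar_eps_phi[OF i bc(1), of b'] R.bar_eps_phi[OF i bc(2), of c']
      L.ebar_op_SomeD(1)[OF bc(1), of b'] R.ebar_op_SomeD(1)[OF bc(2), of c']
      L.fbar_op_SomeD(1)[OF bc(1), of b'] R.fbar_op_SomeD(1)[OF bc(2), of c']
    by (auto simp: tensor_eq_Some_iff split: if_splits)
  then show "eps (gl_tensor P Q) i (b', c') = eps (gl_tensor P Q) i (b, c)"
    "phi (gl_tensor P Q) i (b', c') = phi (gl_tensor P Q) i (b, c)"
    using bc by (simp_all add: eps_gl_tensor[OF i1] phi_gl_tensor[OF i1])
qed

lemma ebar_iff_fbar_q_tensor:
  assumes "b \<in> elems P" "c \<in> elems Q" "b' \<in> elems P" "c' \<in> elems Q"
  shows "ebar_op (q_tensor P Q) (b, c) = Some (b', c') \<longleftrightarrow>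
    fbar_op (q_tensor P Q) (b', c') = Some (b, c)"
proof -
  have "ebar_op P b = Some b' \<longleftrightarrow> fbar_op P b' = Some b" "ebar_op Q c = Some c' \<longleftrightarrow> fbar_op Q c' = Some c"
    using assms L.ebar_iff_fbar R.ebar_iff_fbar by blast+
  \<comment> \<open>The condition is tested at \<open>b\<close> for one operator and at
    \<open>b'\<close> for the other; both tests give the same answer.\<close>
  moreover have "ebar_op P b = Some b' \<Longrightarrow> \<not> wt_zero P b \<and> \<not> wt_zero P b'"
    using assms L.ebar_op_SomeD by blast
  ultimately show ?thesis
    by (cases "wt_zero P b"; cases "wt_zero P b'") (auto simp: tensor_eq_Some_iff)
qed

lemma ebar_wt_q_tensor:
  assumes bc: "b \<in> elems P" "c \<in> elems Q"
    and p: "ebar_op (q_tensor P Q) (b, c) = Some (b', c')"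
  shows "eps_bar (q_tensor P Q) (b, c) = 2 \<Longrightarrow>
      wt_diff (wt (q_tensor P Q) (b', c')) (wt (q_tensor P Q) (b, c)) = unit_vec 1"
    and "eps_bar (q_tensor P Q) (b, c) = 1 \<Longrightarrow>
      wt_diff (wt (q_tensor P Q) (b', c')) (wt (q_tensor P Q) (b, c)) = - unit_vec 2"
proof -
  have *: "(eps_bar (q_tensor P Q) (b, c) = 2 \<longrightarrow>
      wt_diff (wt (q_tensor P Q) (b', c')) (wt (q_tensor P Q) (b, c)) = unit_vec 1) \<and>
    (eps_bar (q_tensor P Q) (b, c) = 1 \<longrightarrow>
      wt_diff (wt (q_tensor P Q) (b', c')) (wt (q_tensor P Q) (b, c)) = - unit_vec 2)"
  proof (cases "wt_zero P b")
    case True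
    then have c': "ebar_op Q c = Some c'" "b' = b"
      using p by (auto simp: tensor_eq_Some_iff)
    moreover have "wt_diff (wt (q_tensor P Q) (b', c')) (wt (q_tensor P Q) (b, c))
        = wt_diff (wt Q c') (wt Q c)"
      using c' by (simp add: wt_diff_def)
    ultimately show ?thesis
      using True bar_string_q_tensor(1)[OF bc] R.ebar_op_SomeD(1)[OF bc(2) c'(1)]
        R.ebar_wt_1[OF bc(2) _ c'(1)] R.ebar_wt_2[OF bc(2) _ c'(1)] by simp
  next
    case False
    then have b': "ebar_op P b = Some b'" "c' = c"
      using p by (auto simp: tensor_eq_Some_iff split: if_splits)
    moreover have "wt_diff (wt (q_tensor P Q) (b', c')) (wt (q_tensor P Q) (b, c))
        = wt_diff (wt P b') (wt P b)"
      using b' by (simp add: wt_diff_def)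
    ultimately show ?thesis
      using False bar_string_q_tensor(1)[OF bc] L.ebar_op_SomeD(1)[OF bc(1) b'(1)]
        L.ebar_wt_1[OF bc(1) _ b'(1)] L.ebar_wt_2[OF bc(1) _ b'(1)] by auto
  qed
  show "eps_bar (q_tensor P Q) (b, c) = 2 \<Longrightarrow>
      wt_diff (wt (q_tensor P Q) (b', c')) (wt (q_tensor P Q) (b, c)) = unit_vec 1"
    "eps_bar (q_tensor P Q) (b, c) = 1 \<Longrightarrow>
      wt_diff (wt (q_tensor P Q) (b', c')) (wt (q_tensor P Q) (b, c)) = - unit_vec 2"
    using * by blast+
qed

lemma sqrt_q_crystal_q_tensor_axioms: "sqrt_q_crystal n (q_tensor P Q)"
proof (rule sqrt_q_crystal.intro)
  show "sqrt_gl_crystal n (q_tensor P Q)"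
    using tensor.sqrt_gl_crystal_axioms by (simp add: sqrt_gl_crystal_q_tensor_iff)
  show "sqrt_q_crystal_axioms n (q_tensor P Q)"
  proof
    fix p q assume "p \<in> elems (q_tensor P Q)" "ebar_op (q_tensor P Q) p = Some q"
    then show "q \<in> elems (q_tensor P Q)"
      using L.ebar_closed R.ebar_closed
      by (cases p) (auto simp: tensor_eq_Some_iff split: if_splits)
  next
    fix p q assume "p \<in> elems (q_tensor P Q)" "fbar_op (q_tensor P Q) p = Some q"
    then show "q \<in> elems (q_tensor P Q)"
      using L.fbar_closed R.fbar_closed
      by (cases p) (auto simp: tensor_eq_Some_iff split: if_splits)
  next
    fix i g h assume "i \<in> {3..n - 1}" "g \<in> {ebar_op (q_tensor P Q), fbar_op (q_tensor P Q)}"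
      "h \<in> {e_op (q_tensor P Q) i, f_op (q_tensor P Q) i}"
    then show "ops_commute (elems (q_tensor P Q)) g h" by (rule bar_commute_q_tensor)
  next
    fix i g s assume "i \<in> {3..n - 1}" "g \<in> {ebar_op (q_tensor P Q), fbar_op (q_tensor P Q)}"
      "s \<in> {eps (q_tensor P Q) i, phi (q_tensor P Q) i}"
    then show "preserves (elems (q_tensor P Q)) g s"
      unfolding preserves_def
      \<comment> \<open>The barred operators of the product are kept folded so that the premises of
        \<open>bar_preserves_q_tensor\<close> match.\<close>
      using bar_preserves_q_tensor[of i] by (force simp del: q_tensor_simps(5,6))
  next
    fix p assume "p \<in> elems (q_tensor P Q)"
    then obtain b c where p: "p = (b, c)" "b \<in> elems P" "c \<in> elems Q" by (cases p) auto
    then show "eps_bar (q_tensor P Q) p + phi_bar (q_tensor P Q) p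
        = (if wt (q_tensor P Q) p 1 = 0 \<and> wt (q_tensor P Q) p 2 = 0 then 0 else 2)"
      \<comment> \<open>If \<open>b\<close> has \<open>wt_zero\<close>, the string axiom for
        \<open>c\<close> gives the value; otherwise both sides are 2 by the axiom for
        \<open>b\<close>.\<close>
      unfolding wt_zero_def[symmetric]
      using bar_string_q_tensor[of b c] L.bar_string_wt_zero R.bar_string_wt_zero by simp
  next
    fix p q assume "p \<in> elems (q_tensor P Q)" "q \<in> elems (q_tensor P Q)"
    then show "ebar_op (q_tensor P Q) p = Some q \<longleftrightarrow> fbar_op (q_tensor P Q) q = Some p"
      using ebar_iff_fbar_q_tensor[of "fst p" "snd p" "fst q" "snd q"] by auto
  next
    fix p q assume "p \<in> elems (q_tensor P Q)" "ebar_op (q_tensor P Q) p = Some q"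
      "eps_bar (q_tensor P Q) p = 2"
    then show "wt_diff (wt (q_tensor P Q) q) (wt (q_tensor P Q) p) = unit_vec 1"
      using ebar_wt_q_tensor(1)[of "fst p" "snd p" "fst q" "snd q"] by auto
  next
    fix p q assume "p \<in> elems (q_tensor P Q)" "ebar_op (q_tensor P Q) p = Some q"
      "eps_bar (q_tensor P Q) p = 1"
    then show "wt_diff (wt (q_tensor P Q) q) (wt (q_tensor P Q) p) = - unit_vec 2"
      using ebar_wt_q_tensor(2)[of "fst p" "snd p" "fst q" "snd q"] by auto
  qed
qed

end

lemma sqrt_q_crystal_q_tensor:
  assumes "sqrt_q_crystal n P" "sqrt_q_crystal n Q"
  shows "sqrt_q_crystal n (q_tensor P Q)"
  using assms by (intro q_crystal_pair.sqrt_q_crystal_q_tensor_axioms q_crystal_pair.intro)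

lemma gl_isomorphism_q_tensor_iff [simp]:
  "gl_isomorphism n F (q_tensor P Q) (q_tensor P' Q') \<longleftrightarrow>
    gl_isomorphism n F (gl_tensor P Q) (gl_tensor P' Q')"
  by (simp add: gl_isomorphism_def sqrt_gl_crystal_q_tensor_iff)

text \<open>In both bracketings a barred operator acts on the first factor without
  \<open>wt_zero\<close> among the first two, and on the third if there is none.\<close>

lemma q_isomorphism_assoc_map:
  assumes "sqrt_q_crystal n P" "sqrt_q_crystal n Q" "sqrt_q_crystal n R"
  shows "q_isomorphism n assoc_map (q_tensor P (q_tensor Q R)) (q_tensor (q_tensor P Q) R)"
proof -
  have "gl_isomorphism n assoc_map (q_tensor P (q_tensor Q R)) (q_tensor (q_tensor P Q) R)"
    using assms by (simp add: gl_isomorphism_assoc_map sqrt_q_crystal.axioms(1))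
  moreover have "sqrt_q_crystal n (q_tensor P (q_tensor Q R))"
    "sqrt_q_crystal n (q_tensor (q_tensor P Q) R)"
    using assms by (simp_all add: sqrt_q_crystal_q_tensor)
  ultimately show ?thesis
    unfolding q_isomorphism_def by auto
qed

theorem theorem3p27:
  fixes n :: nat
    and B :: "'a gl_data" and C :: "'b gl_data" and D :: "'c gl_data"
    and P :: "'a q_data" and Q :: "'b q_data" and R :: "'c q_data"
  assumes "n \<ge> 2"
  shows "(sqrt_gl_crystal n B \<and> sqrt_gl_crystal n C
            \<longrightarrow> sqrt_gl_crystal n (gl_tensor B C))
       \<and> (sqrt_q_crystal n P \<and> sqrt_q_crystal n Q
            \<longrightarrow> sqrt_q_crystal n (q_tensor P Q))
       \<and> (sqrt_gl_crystal n B \<and> sqrt_gl_crystal n C \<and> sqrt_gl_crystal n D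
            \<longrightarrow> gl_isomorphism n assoc_map
                  (gl_tensor B (gl_tensor C D)) (gl_tensor (gl_tensor B C) D))
       \<and> (sqrt_q_crystal n P \<and> sqrt_q_crystal n Q \<and> sqrt_q_crystal n R
            \<longrightarrow> q_isomorphism n assoc_map
                  (q_tensor P (q_tensor Q R)) (q_tensor (q_tensor P Q) R))"
  by (intro conjI impI; elim conjE)
    (simp_all add: sqrt_gl_crystal_gl_tensor sqrt_q_crystal_q_tensor gl_isomorphism_assoc_map
      q_isomorphism_assoc_map)

end
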